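(* Let $n\geq 1$ be an integer and, for each $i\in\{1,\ldots,n\}$, let $L_i,M_i$ be bounded lattices and $h_i:L_i\to M_i$ a bounded lattice morphism. Let $L=\bigoplus_{i=1}^nL_i$, $M=\bigoplus_{i=1}^nM_i$ be the ordinal sums and $h=\bigoplus_{i=1}^nh_i:L\to M$. Then: (1) $h$ is admissible iff $h_1,\ldots,h_n$ are admissible; (2) if $h$ is admissible, then: $h$ fulfills GU iff $h_1,\ldots,h_n$ fulfill GU; (3) if $h$ is admissible, then: $h$ fulfills LO iff $h_1,\ldots,h_n$ fulfill LO.
   Context: Bounded lattices are considered as algebras with operations $\vee,\wedge,0,1$; bounded lattice morphisms preserve these. The ordinal sum $K\oplus K'$ of two bounded lattices is obtained by placing $K'$ on top of $K$ and identifying the greatest element of $K$ with the least element of $K'$; finite ordinal sums are iterated. For bounded lattice morphisms $g:K\to N$, $g':K'\to N'$, the morphism $g\oplus g':K\oplus K'\to N\oplus N'$ is given by $(g\oplus g')(x)=g(x)$ for $x\in K$ and $(g\oplus g')(x)=g'(x)$ for $x\in K'$. For a bounded lattice $K$, $\mathrm{Con}(K)$ is its congruence lattice, $\Delta_K$ is the equality relation and $\nabla_K=K^2$. Since the variety of bounded lattices is congruence-distributive, the commutator of congruences is the intersection, so a congruence $\phi\neq\nabla_K$ is prime if, for all $\alpha,\beta\in\mathrm{Con}(K)$, $\alpha\cap\beta\subseteq\phi$ implies $\alpha\subseteq\phi$ or $\beta\subseteq\phi$; $\mathrm{Spec}(K)$ is the set of prime congruences of $K$. For a bounded lattice morphism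 $f:A\to B$ and $\psi\in\mathrm{Con}(B)$, $f^*(\psi)=\{(x,y)\in A^2 : (f(x),f(y))\in\psi\}\in\mathrm{Con}(A)$ and $\mathrm{Ker}(f)=f^*(\Delta_B)$. The morphism $f$ is admissible if $f^*(\psi)\in\mathrm{Spec}(A)$ for all $\psi\in\mathrm{Spec}(B)$. An admissible morphism $f:A\to B$ fulfills GU (Going Up) if for all $\phi,\psi\in\mathrm{Spec}(A)$ and $\phi_1\in\mathrm{Spec}(B)$ with $\phi\subseteq\psi$ and $f^*(\phi_1)=\phi$ there is $\psi_1\in\mathrm{Spec}(B)$ with $\phi_1\subseteq\psi_1$ and $f^*(\psi_1)=\psi$; it fulfills LO (Lying Over) if for every $\phi\in\mathrm{Spec}(A)$ with $\mathrm{Ker}(f)\subseteq\phi$ there is $\phi_1\in\mathrm{Spec}(B)$ with $f^*(\phi_1)=\phi$. *)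

theory Defs
  imports "HOL-Algebra.Lattice"
begin

text \<open>
  The operations of a bounded lattice \<open>K\<close> (locale \<open>bounded_lattice\<close>) are the
  derived ones of HOL-Algebra. One-element lattices are allowed.
\<close>

definition bounded_lattice_hom ::
  "'a gorder \<Rightarrow> 'b gorder \<Rightarrow> ('a \<Rightarrow> 'b) set" where
  "bounded_lattice_hom A B =
    {f \<in> carrier A \<rightarrow> carrier B.
       join_pres A B f \<and> meet_pres A B f \<and>
       f \<bottom>\<^bsub>A\<^esub> = \<bottom>\<^bsub>B\<^esub> \<and> f \<top>\<^bsub>A\<^esub> = \<top>\<^bsub>B\<^esub>}"

definition Con :: "'a gorder \<Rightarrow> ('a \<times> 'a) set set" where
  "Con K =
    {\<theta>. equiv (carrier K) \<theta> \<and>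
         (\<forall>(x, x') \<in> \<theta>. \<forall>(y, y') \<in> \<theta>.
            (x \<squnion>\<^bsub>K\<^esub> y, x' \<squnion>\<^bsub>K\<^esub> y') \<in> \<theta> \<and>
            (x \<sqinter>\<^bsub>K\<^esub> y, x' \<sqinter>\<^bsub>K\<^esub> y') \<in> \<theta>)}"

definition Spec :: "'a gorder \<Rightarrow> ('a \<times> 'a) set set" where
  "Spec K =
    {\<phi> \<in> Con K. \<phi> \<noteq> carrier K \<times> carrier K \<and>
       (\<forall>\<alpha> \<in> Con K. \<forall>\<beta> \<in> Con K. \<alpha> \<inter> \<beta> \<subseteq> \<phi> \<longrightarrow> \<alpha> \<subseteq> \<phi> \<or> \<beta> \<subseteq> \<phi>)}"

definition cong_pullback ::
  "'a gorder \<Rightarrow> ('a \<Rightarrow> 'b) \<Rightarrow> ('b \<times> 'b) set \<Rightarrow> ('a \<times> 'a) set" where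
  "cong_pullback A f \<psi> =
    {(x, y). x \<in> carrier A \<and> y \<in> carrier A \<and> (f x, f y) \<in> \<psi>}"

definition Ker :: "'a gorder \<Rightarrow> 'b gorder \<Rightarrow> ('a \<Rightarrow> 'b) \<Rightarrow> ('a \<times> 'a) set" where
  "Ker A B f = cong_pullback A f (Id_on (carrier B))"

definition admissible :: "'a gorder \<Rightarrow> 'b gorder \<Rightarrow> ('a \<Rightarrow> 'b) \<Rightarrow> bool" where
  "admissible A B f \<longleftrightarrow>
    f \<in> bounded_lattice_hom A B \<and> (\<forall>\<psi> \<in> Spec B. cong_pullback A f \<psi> \<in> Spec A)"

definition fulfills_GU :: "'a gorder \<Rightarrow> 'b gorder \<Rightarrow> ('a \<Rightarrow> 'b) \<Rightarrow> bool" where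
  "fulfills_GU A B f \<longleftrightarrow>
    (\<forall>\<phi> \<in> Spec A. \<forall>\<psi> \<in> Spec A. \<forall>\<phi>\<^sub>1 \<in> Spec B.
       \<phi> \<subseteq> \<psi> \<and> cong_pullback A f \<phi>\<^sub>1 = \<phi> \<longrightarrow>
       (\<exists>\<psi>\<^sub>1 \<in> Spec B. \<phi>\<^sub>1 \<subseteq> \<psi>\<^sub>1 \<and> cong_pullback A f \<psi>\<^sub>1 = \<psi>))"

definition fulfills_LO :: "'a gorder \<Rightarrow> 'b gorder \<Rightarrow> ('a \<Rightarrow> 'b) \<Rightarrow> bool" where
  "fulfills_LO A B f \<longleftrightarrow>
    (\<forall>\<phi> \<in> Spec A. Ker A B f \<subseteq> \<phi> \<longrightarrow>
       (\<exists>\<phi>\<^sub>1 \<in> Spec B. cong_pullback A f \<phi>\<^sub>1 = \<phi>))"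

text \<open>
  The ordinal sum of \<open>L 1, \<dots>, L n\<close> is the quotient of the tagged disjoint union
  by the equivalence relation generated by identifying the top of \<open>L i\<close> with the
  bottom of \<open>L (i + 1)\<close>. The generated equivalence is needed rather than the bare
  identifications: if \<open>L i\<close> is trivial, its only element is glued on both sides,
  so that several consecutive summands may share an element.
\<close>

definition osum_union :: "nat \<Rightarrow> (nat \<Rightarrow> 'a gorder) \<Rightarrow> (nat \<times> 'a) set" where
  "osum_union n L = (SIGMA i:{1..n}. carrier (L i))"

definition osum_glue :: "nat \<Rightarrow> (nat \<Rightarrow> 'a gorder) \<Rightarrow> ((nat \<times> 'a) \<times> (nat \<times> 'a)) set" where
  "osum_glue n L = {((i, \<top>\<^bsub>L i\<^esub>), (Suc i, \<bottom>\<^bsub>L (Suc i)\<^esub>)) | i. 1 \<le> i \<and> i < n}"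

definition osum_eq :: "nat \<Rightarrow> (nat \<Rightarrow> 'a gorder) \<Rightarrow> ((nat \<times> 'a) \<times> (nat \<times> 'a)) set" where
  "osum_eq n L =
    (osum_glue n L \<union> (osum_glue n L)\<inverse>)\<^sup>* \<inter> (osum_union n L \<times> osum_union n L)"

definition osum :: "nat \<Rightarrow> (nat \<Rightarrow> 'a gorder) \<Rightarrow> (nat \<times> 'a) set gorder" where
  "osum n L =
    \<lparr> carrier = osum_union n L // osum_eq n L,
      eq = (=),
      le = (\<lambda>C D. \<exists>(i, x) \<in> C. \<exists>(j, y) \<in> D. i < j \<or> i = j \<and> x \<sqsubseteq>\<^bsub>L i\<^esub> y) \<rparr>"

text \<open>
  The sum of the maps \<open>h i\<close> sends the class of \<open>(i, x)\<close> to the class of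
  \<open>(i, h i x)\<close> in the ordinal sum of the \<open>M i\<close>; the union below runs over equal
  classes if the \<open>h i\<close> preserve top and bottom.
\<close>

definition osum_map ::
  "nat \<Rightarrow> (nat \<Rightarrow> 'b gorder) \<Rightarrow> (nat \<Rightarrow> 'a \<Rightarrow> 'b) \<Rightarrow> (nat \<times> 'a) set \<Rightarrow> (nat \<times> 'b) set" where
  "osum_map n M h C = (\<Union>(i, x) \<in> C. osum_eq n M `` {(i, h i x)})"

end

theory Submission
  imports Defs
begin

text \<open>
  Every summand \<open>L i\<close> of the ordinal sum \<open>K\<close> is a retract: the projection \<open>p i\<close> sends all
  lower summands to \<open>\<bottom>\<close> and all higher ones to \<open>\<top>\<close>, and with the inclusion \<open>q i\<close> one has
  \<open>q i (p i x) = (x \<squnion> q i \<bottom>) \<sqinter> q i \<top>\<close>. As this is a polynomial in \<open>x\<close>, a congruence of \<open>K\<close> is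
  the intersection of the pullbacks along the \<open>p i\<close> of its restrictions to the summands. A prime
  congruence therefore equals one of these finitely many pullbacks, so \<open>Spec K\<close> is the disjoint
  union of the \<open>Spec (L i)\<close>, and prime congruences from different summands are incomparable.
  Since \<open>h\<close> commutes with the projections, pulling back along \<open>h\<close> acts on the \<open>i\<close>-th part as
  pulling back along \<open>h i\<close>, and all three claims can be read off summand by summand.
\<close>

section \<open>Lattice preliminaries: bounds, uniqueness of joins and meets\<close>

context bounded_lattice
begin

lemma join_bottom_top:
  assumes "x \<in> carrier L"
  shows "\<bottom> \<squnion> x = x" "x \<squnion> \<bottom> = x" "\<top> \<squnion> x = \<top>" "x \<squnion> \<top> = \<top>"
  using bottom_join[OF assms] top_join[OF assms] eq_is_equal by (simp_all add: join_comm)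

lemma meet_bottom_top:
  assumes "x \<in> carrier L"
  shows "\<bottom> \<sqinter> x = \<bottom>" "x \<sqinter> \<bottom> = \<bottom>" "\<top> \<sqinter> x = x" "x \<sqinter> \<top> = x"
  using bottom_meet[OF assms] top_meet[OF assms] eq_is_equal by (simp_all add: meet_comm)

end

text \<open>Least upper bounds are unique in a partial order. Instantiating the predicate of
  \<open>joinI\<close> with equality to \<open>z\<close> reduces the claim to this uniqueness. The
  next lemma is the dual.\<close>

lemma (in upper_semilattice) join_eqI:
  assumes "is_lub L z {x, y}" "x \<in> carrier L" "y \<in> carrier L"
  shows "x \<squnion> y = z"
  using joinI[of x y "\<lambda>l. l = z"] least_unique assms by blast

lemma (in lower_semilattice) meet_eqI:
  assumes "is_glb L z {x, y}" "x \<in> carrier L" "y \<in> carrier L"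
  shows "x \<sqinter> y = z"
  using meetI[of x y "\<lambda>l. l = z"] greatest_unique assms by blast

section \<open>Congruences and prime congruences\<close>

lemma Con_equiv: "\<theta> \<in> Con K \<Longrightarrow> equiv (carrier K) \<theta>"
  and Con_join: "\<theta> \<in> Con K \<Longrightarrow> (x, x') \<in> \<theta> \<Longrightarrow> (y, y') \<in> \<theta> \<Longrightarrow> (x \<squnion>\<^bsub>K\<^esub> y, x' \<squnion>\<^bsub>K\<^esub> y') \<in> \<theta>"
  and Con_meet: "\<theta> \<in> Con K \<Longrightarrow> (x, x') \<in> \<theta> \<Longrightarrow> (y, y') \<in> \<theta> \<Longrightarrow> (x \<sqinter>\<^bsub>K\<^esub> y, x' \<sqinter>\<^bsub>K\<^esub> y') \<in> \<theta>"
  unfolding Con_def by (blast+)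

lemma Con_refl: "\<theta> \<in> Con K \<Longrightarrow> x \<in> carrier K \<Longrightarrow> (x, x) \<in> \<theta>"
  using Con_equiv by (metis equiv_class_self Image_singleton_iff)

lemma Con_sym: "\<theta> \<in> Con K \<Longrightarrow> (x, y) \<in> \<theta> \<Longrightarrow> (y, x) \<in> \<theta>"
  using Con_equiv by (meson equivE symD)

lemma Con_trans: "\<theta> \<in> Con K \<Longrightarrow> (x, y) \<in> \<theta> \<Longrightarrow> (y, z) \<in> \<theta> \<Longrightarrow> (x, z) \<in> \<theta>"
  using Con_equiv by (meson equivE transD)

lemma Con_carrier:
  assumes "\<theta> \<in> Con K" "(x, y) \<in> \<theta>"
  shows "x \<in> carrier K" "y \<in> carrier K"
  using Con_equiv[OF assms(1)] assms(2) by (auto simp: equiv_def refl_on_def)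

text \<open>Meeting the pair of bounds with \<open>(x, x)\<close> yields
  \<open>(\<bottom>, x)\<close>, so every element is congruent to \<bottom>. This is how properness
  of a prime congruence gets contradicted later.\<close>

lemma Con_bottom_top:
  assumes "bounded_lattice K" "\<theta> \<in> Con K" "(\<bottom>\<^bsub>K\<^esub>, \<top>\<^bsub>K\<^esub>) \<in> \<theta>"
  shows "\<theta> = carrier K \<times> carrier K"
proof -
  interpret bounded_lattice K by fact
  have "(\<bottom>\<^bsub>K\<^esub>, x) \<in> \<theta>" if "x \<in> carrier K" for x
    using Con_meet[OF assms(2,3) Con_refl[OF assms(2) that]] that by (simp add: meet_bottom_top)
  then have "(x, y) \<in> \<theta>" if "x \<in> carrier K" "y \<in> carrier K" for x y
    using that Con_trans[OF assms(2) Con_sym[OF assms(2)]] by blast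
  moreover have "\<theta> \<subseteq> carrier K \<times> carrier K"
    using Con_equiv[OF assms(2)] by (rule equiv_type)
  ultimately show ?thesis by blast
qed

text \<open>Stated for maps preserving joins and meets, so that it also covers the inclusion of a
  summand into the ordinal sum, which in general moves the bounds.\<close>

lemma Con_pullback:
  assumes \<psi>: "\<psi> \<in> Con B"
    and f: "f \<in> carrier A \<rightarrow> carrier B" "join_pres A B f" "meet_pres A B f"
  shows "cong_pullback A f \<psi> \<in> Con A"
proof -
  interpret A: lattice A using f(2) by (simp add: join_pres_def)
  have "equiv (carrier A) (cong_pullback A f \<psi>)"
    using f(1) \<psi> unfolding cong_pullback_def
    by (intro equivI refl_onI symI transI) (auto intro: Con_refl Con_sym Con_trans)
  then show ?thesis
    using f \<psi> unfolding Con_def[of A]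
    by (auto simp: cong_pullback_def join_pres_def meet_pres_def intro: Con_join Con_meet)
qed

text \<open>An empty intersection would be the universal relation on the whole type, hence the
  nonempty index set.\<close>

lemma Con_Inter:
  assumes "I \<noteq> {}" "\<And>i. i \<in> I \<Longrightarrow> A i \<in> Con K"
  shows "(\<Inter>i\<in>I. A i) \<in> Con K"
proof -
  have "equiv (carrier K) (\<Inter>i\<in>I. A i)"
  proof (rule equivI)
    show "(\<Inter>i\<in>I. A i) \<subseteq> carrier K \<times> carrier K"
      using Con_equiv[OF assms(2), THEN equiv_type] assms(1) by blast
    show "refl_on (carrier K) (\<Inter>i\<in>I. A i)"
      using assms by (auto intro!: refl_onI Con_refl)
    show "sym (\<Inter>i\<in>I. A i)"
      using Con_sym[OF assms(2)] by (auto intro!: symI)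
    show "trans (\<Inter>i\<in>I. A i)"
      using Con_trans[OF assms(2)] by (auto intro!: transI)
  qed
  then show ?thesis
    using assms(2) by (auto simp: Con_def[of K] intro: Con_join Con_meet)
qed

lemma SpecD:
  assumes "\<phi> \<in> Spec K"
  shows "\<phi> \<in> Con K" "\<phi> \<noteq> carrier K \<times> carrier K"
    "\<alpha> \<in> Con K \<Longrightarrow> \<beta> \<in> Con K \<Longrightarrow> \<alpha> \<inter> \<beta> \<subseteq> \<phi> \<Longrightarrow> \<alpha> \<subseteq> \<phi> \<or> \<beta> \<subseteq> \<phi>"
  using assms unfolding Spec_def by blast+

text \<open>Primality splits off one congruence at a time. The intersection of the remaining ones is
  again a congruence, so the induction can continue.\<close>

lemma Spec_Inter:
  assumes "\<phi> \<in> Spec K" "finite I" "I \<noteq> {}" "\<And>i. i \<in> I \<Longrightarrow> A i \<in> Con K" "(\<Inter>i\<in>I. A i) \<subseteq> \<phi>"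
  shows "\<exists>i\<in>I. A i \<subseteq> \<phi>"
  using assms(2-)
proof (induction I rule: finite_ne_induct)
  case (insert i I)
  then have "A i \<subseteq> \<phi> \<or> (\<Inter>i\<in>I. A i) \<subseteq> \<phi>"
    using SpecD(3)[OF assms(1), of "A i" "\<Inter>i\<in>I. A i"] Con_Inter[of I A K] by auto
  with insert show ?case by blast
qed simp

text \<open>The \<open>i\<close>-th component of an element of the \<open>j\<close>-th summand under the embedding of the
  ordinal sum into the direct product.\<close>

fun osum_coord :: "(nat \<Rightarrow> 'a gorder) \<Rightarrow> nat \<Rightarrow> nat \<times> 'a \<Rightarrow> 'a" where
  "osum_coord L i (j, x) = (if i < j then \<top>\<^bsub>L i\<^esub> else if j < i then \<bottom>\<^bsub>L i\<^esub> else x)"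

text \<open>The choice of a representative is harmless: identified pairs have the same coordinates,
  as \<open>proj_class\<close> shows.\<close>

definition osum_proj :: "(nat \<Rightarrow> 'a gorder) \<Rightarrow> nat \<Rightarrow> (nat \<times> 'a) set \<Rightarrow> 'a" where
  "osum_proj L i C = osum_coord L i (SOME a. a \<in> C)"

definition osum_inj :: "nat \<Rightarrow> (nat \<Rightarrow> 'a gorder) \<Rightarrow> nat \<Rightarrow> 'a \<Rightarrow> (nat \<times> 'a) set" where
  "osum_inj n L i x = osum_eq n L `` {(i, x)}"

section \<open>Coordinates and order of the ordinal sum\<close>

locale ordinal_sum =
  fixes n :: nat and L :: "nat \<Rightarrow> 'a gorder"
  assumes n_pos: "1 \<le> n"
    and bl: "\<And>i. i \<in> {1..n} \<Longrightarrow> bounded_lattice (L i)"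
begin

abbreviation "K \<equiv> osum n L"
abbreviation "p \<equiv> osum_proj L"
abbreviation "q \<equiv> osum_inj n L"

lemma L_closed [simp]:
  assumes "i \<in> {1..n}"
  shows "\<bottom>\<^bsub>L i\<^esub> \<in> carrier (L i)" "\<top>\<^bsub>L i\<^esub> \<in> carrier (L i)"
    "x \<in> carrier (L i) \<Longrightarrow> y \<in> carrier (L i) \<Longrightarrow> x \<squnion>\<^bsub>L i\<^esub> y \<in> carrier (L i)"
    "x \<in> carrier (L i) \<Longrightarrow> y \<in> carrier (L i) \<Longrightarrow> x \<sqinter>\<^bsub>L i\<^esub> y \<in> carrier (L i)"
proof -
  interpret bounded_lattice "L i" by (rule bl[OF assms])
  show "\<bottom>\<^bsub>L i\<^esub> \<in> carrier (L i)" "\<top>\<^bsub>L i\<^esub> \<in> carrier (L i)"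
    "x \<in> carrier (L i) \<Longrightarrow> y \<in> carrier (L i) \<Longrightarrow> x \<squnion>\<^bsub>L i\<^esub> y \<in> carrier (L i)"
    "x \<in> carrier (L i) \<Longrightarrow> y \<in> carrier (L i) \<Longrightarrow> x \<sqinter>\<^bsub>L i\<^esub> y \<in> carrier (L i)"
    by auto
qed

lemma L_le [simp]:
  assumes "i \<in> {1..n}" "x \<in> carrier (L i)"
  shows "\<bottom>\<^bsub>L i\<^esub> \<sqsubseteq>\<^bsub>L i\<^esub> x" "x \<sqsubseteq>\<^bsub>L i\<^esub> \<top>\<^bsub>L i\<^esub>" "x \<sqsubseteq>\<^bsub>L i\<^esub> x"
proof -
  interpret bounded_lattice "L i" by (rule bl[OF assms(1)])
  show "\<bottom>\<^bsub>L i\<^esub> \<sqsubseteq>\<^bsub>L i\<^esub> x" "x \<sqsubseteq>\<^bsub>L i\<^esub> \<top>\<^bsub>L i\<^esub>" "x \<sqsubseteq>\<^bsub>L i\<^esub> x"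
    using assms(2) by auto
qed

lemma L_antisym:
  assumes "i \<in> {1..n}" "x \<in> carrier (L i)" "y \<in> carrier (L i)" "x \<sqsubseteq>\<^bsub>L i\<^esub> y" "y \<sqsubseteq>\<^bsub>L i\<^esub> x"
  shows "x = y"
proof -
  interpret bounded_lattice "L i" by (rule bl[OF assms(1)])
  show ?thesis using assms by auto
qed

lemma L_trans:
  assumes "i \<in> {1..n}" "x \<in> carrier (L i)" "y \<in> carrier (L i)" "z \<in> carrier (L i)"
    "x \<sqsubseteq>\<^bsub>L i\<^esub> y" "y \<sqsubseteq>\<^bsub>L i\<^esub> z"
  shows "x \<sqsubseteq>\<^bsub>L i\<^esub> z"
proof -
  interpret bounded_lattice "L i" by (rule bl[OF assms(1)])
  show ?thesis using assms by (meson le_trans)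
qed

lemma L_join_le:
  assumes "i \<in> {1..n}" "x \<in> carrier (L i)" "y \<in> carrier (L i)" "z \<in> carrier (L i)"
    "x \<sqsubseteq>\<^bsub>L i\<^esub> z" "y \<sqsubseteq>\<^bsub>L i\<^esub> z"
  shows "x \<squnion>\<^bsub>L i\<^esub> y \<sqsubseteq>\<^bsub>L i\<^esub> z"
proof -
  interpret bounded_lattice "L i" by (rule bl[OF assms(1)])
  show ?thesis using assms by (simp add: join_le)
qed

lemma L_join_meet_bounds:
  assumes "i \<in> {1..n}" "x \<in> carrier (L i)" "y \<in> carrier (L i)"
  shows "x \<sqsubseteq>\<^bsub>L i\<^esub> x \<squnion>\<^bsub>L i\<^esub> y" "y \<sqsubseteq>\<^bsub>L i\<^esub> x \<squnion>\<^bsub>L i\<^esub> y"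
    "x \<sqinter>\<^bsub>L i\<^esub> y \<sqsubseteq>\<^bsub>L i\<^esub> x" "x \<sqinter>\<^bsub>L i\<^esub> y \<sqsubseteq>\<^bsub>L i\<^esub> y"
proof -
  interpret bounded_lattice "L i" by (rule bl[OF assms(1)])
  show "x \<sqsubseteq>\<^bsub>L i\<^esub> x \<squnion>\<^bsub>L i\<^esub> y" "y \<sqsubseteq>\<^bsub>L i\<^esub> x \<squnion>\<^bsub>L i\<^esub> y"
    "x \<sqinter>\<^bsub>L i\<^esub> y \<sqsubseteq>\<^bsub>L i\<^esub> x" "x \<sqinter>\<^bsub>L i\<^esub> y \<sqsubseteq>\<^bsub>L i\<^esub> y"
    using assms by (simp_all add: join_left join_right meet_left meet_right)
qed

lemma L_meet_le:
  assumes "i \<in> {1..n}" "x \<in> carrier (L i)" "y \<in> carrier (L i)" "z \<in> carrier (L i)"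
    "z \<sqsubseteq>\<^bsub>L i\<^esub> x" "z \<sqsubseteq>\<^bsub>L i\<^esub> y"
  shows "z \<sqsubseteq>\<^bsub>L i\<^esub> x \<sqinter>\<^bsub>L i\<^esub> y"
proof -
  interpret bounded_lattice "L i" by (rule bl[OF assms(1)])
  show ?thesis using assms by (simp add: meet_le)
qed

lemmas L_simps [simp] =
  bounded_lattice.join_bottom_top[OF bl] bounded_lattice.meet_bottom_top[OF bl]

lemma coord_glue:
  assumes "(a, b) \<in> osum_glue n L"
  shows "osum_coord L i a = osum_coord L i b"
  using assms by (auto simp: osum_glue_def less_Suc_eq)
    (use le_less_Suc_eq in \<open>metis nat_less_le not_less\<close>)

text \<open>If all summands after \<open>j\<close> up to \<open>k\<close> are trivial, then the
  bottom reached by one gluing step is also the top from which the next one starts, so the steps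
  compose.\<close>

lemma chain_glue:
  assumes "1 \<le> j" "j \<le> k" "k < n" "\<And>i. j < i \<Longrightarrow> i \<le> k \<Longrightarrow> \<top>\<^bsub>L i\<^esub> = \<bottom>\<^bsub>L i\<^esub>"
  shows "((j, \<top>\<^bsub>L j\<^esub>), (Suc k, \<bottom>\<^bsub>L (Suc k)\<^esub>)) \<in> (osum_glue n L)\<^sup>*"
  using assms(2-)
proof (induction k rule: dec_induct)
  case base
  then show ?case using assms(1) by (auto simp: osum_glue_def)
next
  case (step k)
  have "((j, \<top>\<^bsub>L j\<^esub>), (Suc k, \<bottom>\<^bsub>L (Suc k)\<^esub>)) \<in> (osum_glue n L)\<^sup>*"
    using step by simp
  moreover have "((Suc k, \<top>\<^bsub>L (Suc k)\<^esub>), (Suc (Suc k), \<bottom>\<^bsub>L (Suc (Suc k))\<^esub>)) \<in> osum_glue n L"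
    using step by (auto simp: osum_glue_def)
  moreover have "\<top>\<^bsub>L (Suc k)\<^esub> = \<bottom>\<^bsub>L (Suc k)\<^esub>"
    using step by simp
  ultimately show ?case by (metis rtrancl.rtrancl_into_rtrancl)
qed

text \<open>The coordinates are a complete invariant of the classes. Each gluing step preserves
  them; conversely, equal coordinates of elements with different tags force everything strictly
  between the two elements to be trivial, which is the situation of
  \<open>chain_glue\<close>.\<close>

lemma osum_eq_iff:
  assumes a: "a \<in> osum_union n L" and b: "b \<in> osum_union n L"
  shows "(a, b) \<in> osum_eq n L \<longleftrightarrow> (\<forall>i\<in>{1..n}. osum_coord L i a = osum_coord L i b)"
proof
  assume "(a, b) \<in> osum_eq n L"
  then have "(a, b) \<in> (osum_glue n L \<union> (osum_glue n L)\<inverse>)\<^sup>*" by (simp add: osum_eq_def)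
  then show "\<forall>i\<in>{1..n}. osum_coord L i a = osum_coord L i b"
  proof induction
    case (step b c)
    then have "osum_coord L i b = osum_coord L i c" for i
      by (metis Un_iff converse_iff coord_glue)
    with step.IH show ?case by simp
  qed simp
next
  \<comment> \<open>From the smaller tag to the larger one, forward gluing steps suffice; the
    symmetric closure is only needed to treat both orders of the tags.\<close>
  have chain: "(a, b) \<in> (osum_glue n L)\<^sup>*"
    if U: "a \<in> osum_union n L" "b \<in> osum_union n L" and "fst a \<le> fst b"
      and eq: "\<forall>i\<in>{1..n}. osum_coord L i a = osum_coord L i b" for a b
  proof -
    obtain j x k y where [simp]: "a = (j, x)" "b = (k, y)" by (cases a, cases b)
    have j: "j \<in> {1..n}" "k \<in> {1..n}" "j \<le> k" using that by (auto simp: osum_union_def)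
    show ?thesis
    proof (cases "j = k")
      case True
      then show ?thesis using bspec[OF eq j(1)] by simp
    next
      case False
      then obtain k' where k': "k = Suc k'" "j \<le> k'" using j by (cases k) auto
      \<comment> \<open>At index \<open>j\<close> the element with the higher tag has coordinate
        \<top>, at index \<open>k\<close> the one with the lower tag has coordinate \<bottom>. At
        indices strictly between, the two coordinates are \<bottom> and \<top>, so their equality
        makes these summands trivial.\<close>
      have "x = \<top>\<^bsub>L j\<^esub>" "y = \<bottom>\<^bsub>L k\<^esub>"
        using bspec[OF eq j(1)] bspec[OF eq j(2)] j k' by auto
      moreover have "\<top>\<^bsub>L i\<^esub> = \<bottom>\<^bsub>L i\<^esub>" if "j < i" "i \<le> k'" for i
        using bspec[OF eq, of i] j k' that by auto
      ultimately show ?thesis using chain_glue[of j k'] j k' by auto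
    qed
  qed
  assume eq: "\<forall>i\<in>{1..n}. osum_coord L i a = osum_coord L i b"
  have "(a, b) \<in> (osum_glue n L)\<^sup>* \<or> (b, a) \<in> (osum_glue n L)\<^sup>*"
    using chain[OF a b] chain[OF b a] eq by (metis nle_le)
  then have "(a, b) \<in> (osum_glue n L \<union> (osum_glue n L)\<inverse>)\<^sup>*"
    by (metis Un_upper1 Un_upper2 converse_iff rtrancl_converse rtrancl_mono subsetD)
  then show "(a, b) \<in> osum_eq n L" using a b by (simp add: osum_eq_def)
qed

lemma equiv_osum_eq: "equiv (osum_union n L) (osum_eq n L)"
proof (rule equivI)
  show sub: "osum_eq n L \<subseteq> osum_union n L \<times> osum_union n L"
    by (auto simp: osum_eq_def)
  show "refl_on (osum_union n L) (osum_eq n L)"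
    by (intro refl_onI) (simp add: osum_eq_iff)
  show "sym (osum_eq n L)"
    using sub by (intro symI) (metis osum_eq_iff mem_Sigma_iff subsetD)
  show "trans (osum_eq n L)"
    using sub by (intro transI) (metis osum_eq_iff mem_Sigma_iff subsetD)
qed

lemma proj_class:
  assumes "i \<in> {1..n}" "a \<in> osum_union n L"
  shows "p i (osum_eq n L `` {a}) = osum_coord L i a"
proof -
  define b where "b = (SOME b. b \<in> osum_eq n L `` {a})"
  have "a \<in> osum_eq n L `` {a}"
    using equiv_class_self[OF equiv_osum_eq assms(2)] .
  then have "b \<in> osum_eq n L `` {a}"
    unfolding b_def by (rule someI)
  then have "(a, b) \<in> osum_eq n L" "b \<in> osum_union n L" by (auto simp: osum_eq_def)
  then show ?thesis
    using osum_eq_iff[OF assms(2), of b] assms(1)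
    unfolding osum_proj_def b_def[symmetric] by metis
qed

lemma proj_inj:
  assumes "i \<in> {1..n}" "j \<in> {1..n}" "x \<in> carrier (L j)"
  shows "p i (q j x) = (if i < j then \<top>\<^bsub>L i\<^esub> else if j < i then \<bottom>\<^bsub>L i\<^esub> else x)"
  using assms proj_class[of i "(j, x)"] by (auto simp: osum_inj_def osum_union_def)

lemma inj_closed [simp]: "j \<in> {1..n} \<Longrightarrow> x \<in> carrier (L j) \<Longrightarrow> q j x \<in> carrier K"
  by (auto simp: osum_inj_def osum_union_def osum_def intro: quotientI)

lemma carrier_cases:
  assumes "C \<in> carrier K"
  obtains j x where "j \<in> {1..n}" "x \<in> carrier (L j)" "C = q j x"
  using assms by (auto simp: osum_inj_def osum_union_def osum_def elim!: quotientE)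

lemma proj_closed [simp]:
  assumes "i \<in> {1..n}" "C \<in> carrier K"
  shows "p i C \<in> carrier (L i)"
  using assms(2) by (cases rule: carrier_cases) (use assms(1) in \<open>simp add: proj_inj\<close>)

lemma inj_eq_iff:
  assumes "j \<in> {1..n}" "x \<in> carrier (L j)" "k \<in> {1..n}" "y \<in> carrier (L k)"
  shows "q j x = q k y \<longleftrightarrow> (\<forall>i\<in>{1..n}. osum_coord L i (j, x) = osum_coord L i (k, y))"
proof -
  have "(j, x) \<in> osum_union n L" "(k, y) \<in> osum_union n L"
    using assms by (auto simp: osum_union_def)
  then show ?thesis
    unfolding osum_inj_def
    by (metis eq_equiv_class_iff[OF equiv_osum_eq] osum_eq_iff)
qed

text \<open>The ordinal sum embeds into the direct product of the summands, so equations in it can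
  be checked coordinatewise.\<close>

lemma proj_eqI:
  assumes "C \<in> carrier K" "D \<in> carrier K" "\<And>i. i \<in> {1..n} \<Longrightarrow> p i C = p i D"
  shows "C = D"
proof -
  obtain j x k y where *: "j \<in> {1..n}" "x \<in> carrier (L j)" "C = q j x"
      "k \<in> {1..n}" "y \<in> carrier (L k)" "D = q k y"
    using assms(1,2) by (metis carrier_cases)
  then show ?thesis
    using assms(3) by (simp add: inj_eq_iff proj_inj)
qed

lemma coord_mono:
  assumes "i \<in> {1..n}" "(j, x) \<in> osum_union n L" "(k, y) \<in> osum_union n L"
    and "j < k \<or> j = k \<and> x \<sqsubseteq>\<^bsub>L j\<^esub> y"
  shows "osum_coord L i (j, x) \<sqsubseteq>\<^bsub>L i\<^esub> osum_coord L i (k, y)"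
  using assms by (auto simp: osum_union_def)

text \<open>The order, defined through some pair of representatives, is the one induced from the
  direct product. All lattice structure below is computed coordinatewise from this.\<close>

lemma le_iff:
  assumes C: "C \<in> carrier K" and D: "D \<in> carrier K"
  shows "C \<sqsubseteq>\<^bsub>K\<^esub> D \<longleftrightarrow> (\<forall>i\<in>{1..n}. p i C \<sqsubseteq>\<^bsub>L i\<^esub> p i D)"
proof
  assume "C \<sqsubseteq>\<^bsub>K\<^esub> D"
  then obtain j x k y where m: "(j, x) \<in> C" "(k, y) \<in> D" and *: "j < k \<or> j = k \<and> x \<sqsubseteq>\<^bsub>L j\<^esub> y"
    by (auto simp: osum_def)
  have quot: "C \<in> osum_union n L // osum_eq n L" "D \<in> osum_union n L // osum_eq n L"
    using C D by (simp_all add: osum_def)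
  have "C = osum_eq n L `` {(j, x)}" "D = osum_eq n L `` {(k, y)}"
    using m quot by (auto elim!: quotientE dest: equiv_class_eq[OF equiv_osum_eq])
  moreover have "(j, x) \<in> osum_union n L" "(k, y) \<in> osum_union n L"
    using m quot in_quotient_imp_subset[OF equiv_osum_eq] by blast+
  ultimately
  show "\<forall>i\<in>{1..n}. p i C \<sqsubseteq>\<^bsub>L i\<^esub> p i D"
    using coord_mono[OF _ _ _ *] by (simp add: proj_class del: osum_coord.simps)
next
  assume le: "\<forall>i\<in>{1..n}. p i C \<sqsubseteq>\<^bsub>L i\<^esub> p i D"
  obtain j x k y where *: "j \<in> {1..n}" "x \<in> carrier (L j)" "C = q j x"
      "k \<in> {1..n}" "y \<in> carrier (L k)" "D = q k y"
    using C D by (metis carrier_cases)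
  have mem: "(j, x) \<in> C" "(k, y) \<in> D"
    using * equiv_class_self[OF equiv_osum_eq] by (auto simp: osum_inj_def osum_union_def)
  have leI: "C \<sqsubseteq>\<^bsub>K\<^esub> D" if "(j, x) \<in> C" "(k, y) \<in> D" "j < k \<or> j = k \<and> x \<sqsubseteq>\<^bsub>L j\<^esub> y" for j x k y
    unfolding osum_def using rev_bexI[OF that(1)] rev_bexI[OF that(2)] that(3) by simp
  show "C \<sqsubseteq>\<^bsub>K\<^esub> D"
  proof (cases j k rule: linorder_cases)
    case less
    then show ?thesis using leI mem by blast
  next
    case equal
    moreover have "x \<sqsubseteq>\<^bsub>L j\<^esub> y"
      using equal bspec[OF le *(1)] * by (simp add: proj_inj)
    ultimately show ?thesis using leI mem by blast
  next
    case greater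
    \<comment> \<open>A larger tag already makes every coordinate of \<open>C\<close> at least that
      of \<open>D\<close>. With the assumed converse the two classes coincide, and one common
      representative witnesses reflexivity.\<close>
    have "p i D \<sqsubseteq>\<^bsub>L i\<^esub> p i C" if "i \<in> {1..n}" for i
      using that greater * by (simp add: proj_inj)
    then have "C = D"
      using le C D by (intro proj_eqI) (simp_all add: L_antisym)
    then show ?thesis using leI mem(1) * L_le(3) by blast
  qed
qed

section \<open>The ordinal sum as a bounded lattice\<close>

text \<open>As the order is coordinatewise, an element whose coordinates are the joins of the
  coordinates is a least upper bound. Whether such an element exists in the sum is settled in
  \<open>join_exists\<close>.\<close>

lemma osum_lub:
  assumes "C \<in> carrier K" "D \<in> carrier K" "E \<in> carrier K"
    and eq: "\<And>i. i \<in> {1..n} \<Longrightarrow> p i E = p i C \<squnion>\<^bsub>L i\<^esub> p i D"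
  shows "is_lub K E {C, D}"
proof (rule least_UpperI)
  fix X assume "X \<in> {C, D}"
  then show "X \<sqsubseteq>\<^bsub>K\<^esub> E"
    using assms by (auto simp: le_iff L_join_meet_bounds)
next
  fix X assume "X \<in> Upper K {C, D}"
  then have "X \<in> carrier K" "C \<sqsubseteq>\<^bsub>K\<^esub> X" "D \<sqsubseteq>\<^bsub>K\<^esub> X"
    using assms by (auto simp: Upper_def)
  then show "E \<sqsubseteq>\<^bsub>K\<^esub> X"
    using assms by (auto simp: le_iff eq intro: L_join_le)
qed (use assms in auto)

lemma osum_glb:
  assumes "C \<in> carrier K" "D \<in> carrier K" "E \<in> carrier K"
    and eq: "\<And>i. i \<in> {1..n} \<Longrightarrow> p i E = p i C \<sqinter>\<^bsub>L i\<^esub> p i D"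
  shows "is_glb K E {C, D}"
proof (rule greatest_LowerI)
  fix X assume "X \<in> {C, D}"
  then show "E \<sqsubseteq>\<^bsub>K\<^esub> X"
    using assms by (auto simp: le_iff L_join_meet_bounds)
next
  fix X assume "X \<in> Lower K {C, D}"
  then have "X \<in> carrier K" "X \<sqsubseteq>\<^bsub>K\<^esub> C" "X \<sqsubseteq>\<^bsub>K\<^esub> D"
    using assms by (auto simp: Lower_def)
  then show "X \<sqsubseteq>\<^bsub>K\<^esub> E"
    using assms by (auto simp: le_iff eq intro: L_meet_le)
qed (use assms in auto)

text \<open>The image in the direct product is closed under joins: with different tags the element
  with the larger tag is the join, with equal tags the join is formed inside the common summand.
  Meets are dual.\<close>

lemma join_exists:
  assumes "C \<in> carrier K" "D \<in> carrier K"
  shows "\<exists>E\<in>carrier K. \<forall>i\<in>{1..n}. p i E = p i C \<squnion>\<^bsub>L i\<^esub> p i D"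
proof -
  obtain j x k y where *: "j \<in> {1..n}" "x \<in> carrier (L j)" "C = q j x"
      "k \<in> {1..n}" "y \<in> carrier (L k)" "D = q k y"
    using assms by (metis carrier_cases)
  define E where "E = (if j < k then D else if k < j then C else q j (x \<squnion>\<^bsub>L j\<^esub> y))"
  have "E \<in> carrier K" "\<forall>i\<in>{1..n}. p i E = p i C \<squnion>\<^bsub>L i\<^esub> p i D"
    using * by (auto simp: E_def proj_inj)
  then show ?thesis by blast
qed

lemma meet_exists:
  assumes "C \<in> carrier K" "D \<in> carrier K"
  shows "\<exists>E\<in>carrier K. \<forall>i\<in>{1..n}. p i E = p i C \<sqinter>\<^bsub>L i\<^esub> p i D"
proof -
  obtain j x k y where *: "j \<in> {1..n}" "x \<in> carrier (L j)" "C = q j x"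
      "k \<in> {1..n}" "y \<in> carrier (L k)" "D = q k y"
    using assms by (metis carrier_cases)
  define E where "E = (if j < k then C else if k < j then D else q j (x \<sqinter>\<^bsub>L j\<^esub> y))"
  have "E \<in> carrier K" "\<forall>i\<in>{1..n}. p i E = p i C \<sqinter>\<^bsub>L i\<^esub> p i D"
    using * by (auto simp: E_def proj_inj)
  then show ?thesis by blast
qed

lemma partial_order_osum: "partial_order K"
proof -
  have eq: "(.=\<^bsub>K\<^esub>) = (=)" by (simp add: osum_def)
  show ?thesis
  proof
    show "(.=\<^bsub>K\<^esub>) = (=)" by (fact eq)
    fix x y z
    show "x .=\<^bsub>K\<^esub> y" if "x \<sqsubseteq>\<^bsub>K\<^esub> y" "y \<sqsubseteq>\<^bsub>K\<^esub> x" "x \<in> carrier K" "y \<in> carrier K"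
      unfolding eq using that by (intro proj_eqI) (simp_all add: le_iff L_antisym)
    show "x \<sqsubseteq>\<^bsub>K\<^esub> z"
      if "x \<sqsubseteq>\<^bsub>K\<^esub> y" "y \<sqsubseteq>\<^bsub>K\<^esub> z" "x \<in> carrier K" "y \<in> carrier K" "z \<in> carrier K"
      using that by (simp only: le_iff) (metis L_trans proj_closed)
  qed (auto simp: le_iff eq)
qed

lemma osum_bottom: "q 1 \<bottom>\<^bsub>L 1\<^esub> \<in> carrier K" "i \<in> {1..n} \<Longrightarrow> p i (q 1 \<bottom>\<^bsub>L 1\<^esub>) = \<bottom>\<^bsub>L i\<^esub>"
  using n_pos proj_inj[of i 1 "\<bottom>\<^bsub>L 1\<^esub>"] by auto

lemma osum_top: "q n \<top>\<^bsub>L n\<^esub> \<in> carrier K" "i \<in> {1..n} \<Longrightarrow> p i (q n \<top>\<^bsub>L n\<^esub>) = \<top>\<^bsub>L i\<^esub>"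
  using n_pos by (auto simp: proj_inj)

lemma bounded_lattice_osum: "bounded_lattice K"
proof -
  interpret partial_order K by (rule partial_order_osum)
  \<comment> \<open>All coordinates of \<open>q 1 \<bottom>\<close> are \<bottom> and all those of
    \<open>q n \<top>\<close> are \<top>, so these two classes are the extreme elements.\<close>
  have "q 1 \<bottom>\<^bsub>L 1\<^esub> \<sqsubseteq>\<^bsub>K\<^esub> C" "C \<sqsubseteq>\<^bsub>K\<^esub> q n \<top>\<^bsub>L n\<^esub>" if "C \<in> carrier K" for C
    using that L_le proj_closed osum_bottom osum_top by (metis le_iff)+
  then have "least K (q 1 \<bottom>\<^bsub>L 1\<^esub>) (carrier K)" "greatest K (q n \<top>\<^bsub>L n\<^esub>) (carrier K)"
    using osum_bottom(1) osum_top(1) by (auto simp only: least_def greatest_def subset_refl)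
  then show ?thesis
    by unfold_locales (metis join_exists osum_lub, metis meet_exists osum_glb, blast+)
qed

sublocale K: bounded_lattice K
  by (rule bounded_lattice_osum)

text \<open>The join in the sum is unique, hence equal to the element with coordinatewise joins
  found above.\<close>

lemma proj_join [simp]:
  assumes "C \<in> carrier K" "D \<in> carrier K" "i \<in> {1..n}"
  shows "p i (C \<squnion>\<^bsub>K\<^esub> D) = p i C \<squnion>\<^bsub>L i\<^esub> p i D"
  using join_exists[OF assms(1,2)] K.join_eqI[OF osum_lub[OF assms(1,2)]] assms by metis

lemma proj_meet [simp]:
  assumes "C \<in> carrier K" "D \<in> carrier K" "i \<in> {1..n}"
  shows "p i (C \<sqinter>\<^bsub>K\<^esub> D) = p i C \<sqinter>\<^bsub>L i\<^esub> p i D"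
  using meet_exists[OF assms(1,2)] K.meet_eqI[OF osum_glb[OF assms(1,2)]] assms by metis

lemma proj_bottom [simp]: "i \<in> {1..n} \<Longrightarrow> p i \<bottom>\<^bsub>K\<^esub> = \<bottom>\<^bsub>L i\<^esub>"
  by (metis K.bottom_closed K.bottom_lower L_antisym L_closed(1) L_le(1) le_iff osum_bottom proj_closed)

lemma proj_top [simp]: "i \<in> {1..n} \<Longrightarrow> p i \<top>\<^bsub>K\<^esub> = \<top>\<^bsub>L i\<^esub>"
  by (metis K.top_closed K.top_higher L_antisym L_closed(2) L_le(2) le_iff osum_top proj_closed)

section \<open>The summands as retracts of the ordinal sum\<close>

lemma lattice_L: "i \<in> {1..n} \<Longrightarrow> lattice (L i)"
  using bl by (simp add: bounded_lattice_def)

lemma proj_pres: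
  assumes "i \<in> {1..n}"
  shows "p i \<in> carrier K \<rightarrow> carrier (L i)" "join_pres K (L i) (p i)" "meet_pres K (L i) (p i)"
  using assms lattice_L K.lattice_axioms by (auto simp: join_pres_def meet_pres_def)

lemma inj_pres:
  assumes "i \<in> {1..n}"
  shows "q i \<in> carrier (L i) \<rightarrow> carrier K" "join_pres (L i) K (q i)" "meet_pres (L i) K (q i)"
proof -
  have "q i (x \<squnion>\<^bsub>L i\<^esub> y) = q i x \<squnion>\<^bsub>K\<^esub> q i y" "q i (x \<sqinter>\<^bsub>L i\<^esub> y) = q i x \<sqinter>\<^bsub>K\<^esub> q i y"
    if "x \<in> carrier (L i)" "y \<in> carrier (L i)" for x y
    by (rule proj_eqI; use that assms in \<open>simp add: proj_inj\<close>)+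
  then show "q i \<in> carrier (L i) \<rightarrow> carrier K" "join_pres (L i) K (q i)" "meet_pres (L i) K (q i)"
    using assms lattice_L K.lattice_axioms by (auto simp only: join_pres_def meet_pres_def inj_closed Pi_iff)
qed

text \<open>The join with the lower end of the summand raises all coordinates below \<open>i\<close>
  to \<top>, and the meet with its upper end lowers all those above \<open>i\<close> to \<bottom>;
  coordinate \<open>i\<close> is unchanged.\<close>

lemma inj_proj:
  assumes "i \<in> {1..n}" "C \<in> carrier K"
  shows "q i (p i C) = (C \<squnion>\<^bsub>K\<^esub> q i \<bottom>\<^bsub>L i\<^esub>) \<sqinter>\<^bsub>K\<^esub> q i \<top>\<^bsub>L i\<^esub>"
  using assms by (intro proj_eqI) (simp_all add: proj_inj)

lemma inj_top_Suc:
  assumes "1 \<le> j" "j < n"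
  shows "q j \<top>\<^bsub>L j\<^esub> = q (Suc j) \<bottom>\<^bsub>L (Suc j)\<^esub>"
  using assms by (intro proj_eqI) (auto simp: proj_inj not_less less_Suc_eq_le dest: le_antisym)

section \<open>Congruences and the spectrum of the ordinal sum\<close>

abbreviation "P i \<equiv> cong_pullback K (p i)"
abbreviation "Q i \<equiv> cong_pullback (L i) (q i)"

lemma P_Con: "i \<in> {1..n} \<Longrightarrow> \<phi> \<in> Con (L i) \<Longrightarrow> P i \<phi> \<in> Con K"
  by (rule Con_pullback[OF _ proj_pres])

lemma Q_Con: "i \<in> {1..n} \<Longrightarrow> \<phi> \<in> Con K \<Longrightarrow> Q i \<phi> \<in> Con (L i)"
  by (rule Con_pullback[OF _ inj_pres])

text \<open>By \<open>inj_proj\<close>, truncating to the \<open>i\<close>-th summand is a join and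
  a meet with constants, and congruences are compatible with such operations.\<close>

lemma Con_proj:
  assumes "\<phi> \<in> Con K" "i \<in> {1..n}" "(C, D) \<in> \<phi>"
  shows "(p i C, p i D) \<in> Q i \<phi>"
  using assms Con_carrier[OF assms(1,3)]
  by (auto simp: cong_pullback_def inj_proj intro!: Con_join Con_meet Con_refl)

text \<open>A Galois connection: restriction \<open>Q i\<close> is left adjoint to
  \<open>P i\<close>. One direction rests on \<open>p i (q i x) = x\<close>, the other on
  \<open>Con_proj\<close>.\<close>

lemma subset_P_iff:
  assumes "i \<in> {1..n}" "\<phi> \<in> Con K" "\<psi> \<in> Con (L i)"
  shows "\<phi> \<subseteq> P i \<psi> \<longleftrightarrow> Q i \<phi> \<subseteq> \<psi>"
proof
  assume "\<phi> \<subseteq> P i \<psi>"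
  then show "Q i \<phi> \<subseteq> \<psi>"
    using assms(1) by (force simp: cong_pullback_def proj_inj)
next
  assume "Q i \<phi> \<subseteq> \<psi>"
  then show "\<phi> \<subseteq> P i \<psi>"
    using Con_proj[OF assms(2,1)] Con_carrier[OF assms(2)]
    by (auto simp: cong_pullback_def[of K])
qed

text \<open>Since \<open>p i\<close> is a left inverse of \<open>q i\<close>, restriction undoes
  \<open>P i\<close>. In particular \<open>P i\<close> is injective on congruences and reflects
  inclusion.\<close>

lemma Q_P:
  assumes "i \<in> {1..n}" "\<phi> \<in> Con (L i)"
  shows "Q i (P i \<phi>) = \<phi>"
  using assms Con_carrier[OF assms(2)] by (auto simp: cong_pullback_def proj_inj)

lemma P_mono_iff:
  assumes "i \<in> {1..n}" "\<phi> \<in> Con (L i)" "\<psi> \<in> Con (L i)"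
  shows "P i \<phi> \<subseteq> P i \<psi> \<longleftrightarrow> \<phi> \<subseteq> \<psi>"
  using assms by (simp add: subset_P_iff P_Con Q_P)

text \<open>Walk from the lower element to the higher one: up to the top of its own summand, through
  the summands in between, and from the bottom of the last summand to the target. The hypothesis at
  the respective index puts each leg into \<open>\<phi>\<close>, and transitivity joins
  them.\<close>

lemma Con_jointly_determined:
  assumes \<phi>: "\<phi> \<in> Con K" and C: "C \<in> carrier K" and D: "D \<in> carrier K"
    and pq: "\<And>i. i \<in> {1..n} \<Longrightarrow> (q i (p i C), q i (p i D)) \<in> \<phi>"
  shows "(C, D) \<in> \<phi>"
proof -
  have main: "(q j x, q k y) \<in> \<phi>"
    if *: "j \<in> {1..n}" "x \<in> carrier (L j)" "k \<in> {1..n}" "y \<in> carrier (L k)" "j \<le> k"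
      and pq: "\<And>i. i \<in> {1..n} \<Longrightarrow> (q i (p i (q j x)), q i (p i (q k y))) \<in> \<phi>" for j x k y
  proof (cases "j = k")
    case True
    then show ?thesis using pq[of j] * by (simp add: proj_inj)
  next
    case False
    then have "j < k" using * by simp
    \<comment> \<open>Induction along the walk. At an index strictly between \<open>j\<close> and
      \<open>k\<close> the coordinates of the two ends are \<bottom> and \<top>, so
      \<open>\<phi>\<close> collapses that whole summand; its top is the bottom of the next
      one.\<close>
    have "(q j x, q (Suc l) \<bottom>\<^bsub>L (Suc l)\<^esub>) \<in> \<phi>" if "j \<le> l" "l < k" for l
      using that
    proof (induction l rule: dec_induct)
      case base
      then show ?case using pq[of j] * by (simp add: proj_inj inj_top_Suc[symmetric])
    next
      case (step l)
      then have "(q (Suc l) \<bottom>\<^bsub>L (Suc l)\<^esub>, q (Suc l) \<top>\<^bsub>L (Suc l)\<^esub>) \<in> \<phi>"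
        using pq[of "Suc l"] * by (simp add: proj_inj)
      with step show ?case
        using * by (auto simp: inj_top_Suc[symmetric, of "Suc l"] intro: Con_trans[OF \<phi>])
    qed
    from this[of "k - 1"] have "(q j x, q k \<bottom>\<^bsub>L k\<^esub>) \<in> \<phi>"
      using \<open>j < k\<close> by simp
    moreover have "(q k \<bottom>\<^bsub>L k\<^esub>, q k y) \<in> \<phi>"
      using pq[of k] * \<open>j < k\<close> by (simp add: proj_inj)
    ultimately show ?thesis by (rule Con_trans[OF \<phi>])
  qed
  obtain j x k y where *: "j \<in> {1..n}" "x \<in> carrier (L j)" "C = q j x"
      "k \<in> {1..n}" "y \<in> carrier (L k)" "D = q k y"
    using C D by (metis carrier_cases)
  show ?thesis
  proof (cases "j \<le> k")
    case True
    then show ?thesis using main[of j x k y] * pq by blast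
  next
    case False
    then have "(D, C) \<in> \<phi>" using main[of k y j x] * pq Con_sym[OF \<phi>] by auto
    then show ?thesis by (rule Con_sym[OF \<phi>])
  qed
qed

text \<open>Restriction commutes with intersections, and the Galois connection turns inclusion in
  \<open>P i \<phi>\<close> into inclusion of the restriction in \<open>\<phi>\<close>. So primality
  carries over from the summand.\<close>

lemma P_Spec:
  assumes i: "i \<in> {1..n}" and \<phi>: "\<phi> \<in> Spec (L i)"
  shows "P i \<phi> \<in> Spec K"
proof -
  note \<phi>C = SpecD(1)[OF \<phi>]
  have "P i \<phi> \<noteq> carrier K \<times> carrier K"
  proof
    assume "P i \<phi> = carrier K \<times> carrier K"
    then have "Q i (P i \<phi>) = carrier (L i) \<times> carrier (L i)"
      using i by (auto simp: cong_pullback_def)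
    then show False using SpecD(2)[OF \<phi>] Q_P[OF i \<phi>C] by simp
  qed
  moreover have "\<alpha> \<subseteq> P i \<phi> \<or> \<beta> \<subseteq> P i \<phi>"
    if "\<alpha> \<in> Con K" "\<beta> \<in> Con K" "\<alpha> \<inter> \<beta> \<subseteq> P i \<phi>" for \<alpha> \<beta>
  proof -
    have "Q i \<alpha> \<inter> Q i \<beta> \<subseteq> Q i (P i \<phi>)"
      using that(3) by (auto simp: cong_pullback_def[of "L i"])
    then have "Q i \<alpha> \<inter> Q i \<beta> \<subseteq> \<phi>"
      by (simp only: Q_P[OF i \<phi>C])
    then show ?thesis
      using SpecD(3)[OF \<phi>] that i \<phi>C by (simp add: subset_P_iff Q_Con)
  qed
  ultimately show ?thesis
    using P_Con[OF i \<phi>C] unfolding Spec_def by blast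
qed

text \<open>By \<open>Con_jointly_determined\<close> the congruences \<open>P i (Q i \<phi>)\<close>
  intersect inside \<open>\<phi>\<close>, and primality selects one of them that already lies in
  \<open>\<phi>\<close>. The restriction at that index is the prime congruence sought.\<close>

lemma Spec_osumE:
  assumes \<phi>: "\<phi> \<in> Spec K"
  obtains i \<chi> where "i \<in> {1..n}" "\<chi> \<in> Spec (L i)" "\<phi> = P i \<chi>"
proof -
  note \<phi>C = SpecD(1)[OF \<phi>]
  have "(\<Inter>i\<in>{1..n}. P i (Q i \<phi>)) \<subseteq> \<phi>"
  proof
    fix z assume z: "z \<in> (\<Inter>i\<in>{1..n}. P i (Q i \<phi>))"
    obtain C D where [simp]: "z = (C, D)" by (cases z)
    have *: "C \<in> carrier K \<and> D \<in> carrier K \<and> (q i (p i C), q i (p i D)) \<in> \<phi>" if "i \<in> {1..n}" for i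
      using INT_D[OF z that] by (simp add: cong_pullback_def)
    \<comment> \<open>One concrete index is needed to read off that \<open>C\<close> and
      \<open>D\<close> lie in the carrier.\<close>
    have "1 \<in> {1..n}" using n_pos by simp
    then show "z \<in> \<phi>"
      unfolding \<open>z = (C, D)\<close> using * by (blast intro: Con_jointly_determined[OF \<phi>C])
  qed
  then have "\<exists>i\<in>{1..n}. P i (Q i \<phi>) \<subseteq> \<phi>"
    using n_pos P_Con Q_Con \<phi>C by (intro Spec_Inter[OF \<phi>]) auto
  then obtain i where i: "i \<in> {1..n}" "P i (Q i \<phi>) \<subseteq> \<phi>" by blast
  \<comment> \<open>The reverse inclusion is the unit of the Galois connection.\<close>
  then have eq: "P i (Q i \<phi>) = \<phi>"
    using subset_P_iff[OF i(1) \<phi>C Q_Con[OF i(1) \<phi>C]] by blast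
  have "Q i \<phi> \<in> Spec (L i)"
  proof -
    have "Q i \<phi> \<noteq> carrier (L i) \<times> carrier (L i)"
    proof
      assume "Q i \<phi> = carrier (L i) \<times> carrier (L i)"
      then have "P i (Q i \<phi>) = carrier K \<times> carrier K"
        using i(1) by (auto simp: cong_pullback_def[of K])
      then show False using SpecD(2)[OF \<phi>] eq by simp
    qed
    moreover have "\<alpha> \<subseteq> Q i \<phi> \<or> \<beta> \<subseteq> Q i \<phi>"
      if "\<alpha> \<in> Con (L i)" "\<beta> \<in> Con (L i)" "\<alpha> \<inter> \<beta> \<subseteq> Q i \<phi>" for \<alpha> \<beta>
    proof -
      \<comment> \<open>Primality is transported downwards because \<open>P i\<close> preserves
        intersections and reflects inclusion.\<close>
      have "P i \<alpha> \<inter> P i \<beta> \<subseteq> P i (Q i \<phi>)"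
        using that(3) by (auto simp: cong_pullback_def[of K])
      then have "P i \<alpha> \<subseteq> P i (Q i \<phi>) \<or> P i \<beta> \<subseteq> P i (Q i \<phi>)"
        using SpecD(3)[OF \<phi> P_Con[OF i(1) that(1)] P_Con[OF i(1) that(2)]] by (simp only: eq)
      then show ?thesis
        using that i(1) Q_Con[OF i(1) \<phi>C] by (simp only: P_mono_iff)
    qed
    ultimately show ?thesis
      using Q_Con[OF i(1) \<phi>C] unfolding Spec_def by blast
  qed
  then show thesis using that[OF i(1) _ eq[symmetric]] by blast
qed

text \<open>The congruence \<open>P i \<phi>\<close> collapses every summand except the \<open>i\<close>-th.\<close>

lemma P_subset_P_index:
  assumes "i \<in> {1..n}" "j \<in> {1..n}" "\<phi> \<in> Con (L i)" "\<psi> \<in> Spec (L j)" "P i \<phi> \<subseteq> P j \<psi>"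
  shows "i = j"
proof (rule ccontr)
  assume "i \<noteq> j"
  then have "(q j \<bottom>\<^bsub>L j\<^esub>, q j \<top>\<^bsub>L j\<^esub>) \<in> P i \<phi>"
    using assms(1-3) by (auto simp: cong_pullback_def proj_inj intro!: Con_refl)
  then have "(\<bottom>\<^bsub>L j\<^esub>, \<top>\<^bsub>L j\<^esub>) \<in> \<psi>"
    using subsetD[OF assms(5)] assms(2) by (fastforce simp: cong_pullback_def proj_inj)
  then show False
    using Con_bottom_top[OF bl[OF assms(2)]] SpecD[OF assms(4)] by blast
qed

end

section \<open>The sum of the morphisms\<close>

locale ordinal_sum_hom = L: ordinal_sum n L + M: ordinal_sum n M
  for n :: nat and L :: "nat \<Rightarrow> 'a gorder" and M :: "nat \<Rightarrow> 'b gorder" +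
  fixes h :: "nat \<Rightarrow> 'a \<Rightarrow> 'b"
  assumes hom: "\<And>i. i \<in> {1..n} \<Longrightarrow> h i \<in> bounded_lattice_hom (L i) (M i)"
begin

abbreviation "H \<equiv> osum_map n M h"

lemma hom_simps [simp]:
  assumes "i \<in> {1..n}"
  shows "x \<in> carrier (L i) \<Longrightarrow> h i x \<in> carrier (M i)"
    "x \<in> carrier (L i) \<Longrightarrow> y \<in> carrier (L i) \<Longrightarrow> h i (x \<squnion>\<^bsub>L i\<^esub> y) = h i x \<squnion>\<^bsub>M i\<^esub> h i y"
    "x \<in> carrier (L i) \<Longrightarrow> y \<in> carrier (L i) \<Longrightarrow> h i (x \<sqinter>\<^bsub>L i\<^esub> y) = h i x \<sqinter>\<^bsub>M i\<^esub> h i y"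
    "h i \<bottom>\<^bsub>L i\<^esub> = \<bottom>\<^bsub>M i\<^esub>" "h i \<top>\<^bsub>L i\<^esub> = \<top>\<^bsub>M i\<^esub>"
  using hom[OF assms] by (auto simp: bounded_lattice_hom_def join_pres_def meet_pres_def)

text \<open>Off the tag \<open>i\<close> both sides are a bound of \<open>M k\<close>, and
  \<open>h k\<close> preserves the bounds.\<close>

lemma coord_map:
  assumes "k \<in> {1..n}"
  shows "osum_coord M k (i, h i x) = h k (osum_coord L k (i, x))"
  using assms by auto

text \<open>By \<open>coord_map\<close>, all representatives of a class are sent to pairs with equal
  coordinates, so the union defining \<open>osum_map\<close> runs over copies of a single
  class.\<close>

lemma map_inj:
  assumes "j \<in> {1..n}" "x \<in> carrier (L j)"
  shows "H (L.q j x) = M.q j (h j x)"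
proof -
  have "osum_eq n M `` {(i, h i y)} = M.q j (h j x)" if "(i, y) \<in> L.q j x" for i y
  proof -
    have eq: "((j, x), (i, y)) \<in> osum_eq n L" and U: "(j, x) \<in> osum_union n L" "(i, y) \<in> osum_union n L"
      using that by (auto simp: osum_inj_def osum_eq_def)
    then have iy: "i \<in> {1..n}" "y \<in> carrier (L i)"
      by (auto simp: osum_union_def)
    have "M.q i (h i y) = M.q j (h j x)"
      using L.osum_eq_iff[OF U] eq iy assms
      by (subst M.inj_eq_iff) (simp_all add: coord_map del: osum_coord.simps)
    then show ?thesis by (simp add: osum_inj_def)
  qed
  moreover have "(j, x) \<in> L.q j x"
    using assms equiv_class_self[OF L.equiv_osum_eq] by (auto simp: osum_inj_def osum_union_def)
  ultimately show ?thesis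
    unfolding osum_map_def by fastforce
qed

lemma map_closed [simp]: "C \<in> carrier L.K \<Longrightarrow> H C \<in> carrier M.K"
  by (erule L.carrier_cases) (simp add: map_inj)

lemma proj_map [simp]:
  assumes "i \<in> {1..n}" "C \<in> carrier L.K"
  shows "M.p i (H C) = h i (L.p i C)"
  using assms(2)
  by (cases rule: L.carrier_cases) (use assms(1) in \<open>simp add: map_inj L.proj_inj M.proj_inj\<close>)

lemma map_hom: "H \<in> bounded_lattice_hom L.K M.K"
proof -
  have "H (C \<squnion>\<^bsub>L.K\<^esub> D) = H C \<squnion>\<^bsub>M.K\<^esub> H D" "H (C \<sqinter>\<^bsub>L.K\<^esub> D) = H C \<sqinter>\<^bsub>M.K\<^esub> H D"
    if "C \<in> carrier L.K" "D \<in> carrier L.K" for C D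
    by (rule M.proj_eqI; use that in simp)+
  moreover have "H \<bottom>\<^bsub>L.K\<^esub> = \<bottom>\<^bsub>M.K\<^esub>" "H \<top>\<^bsub>L.K\<^esub> = \<top>\<^bsub>M.K\<^esub>"
    by (rule M.proj_eqI; simp)+
  ultimately show ?thesis
    using L.K.lattice_axioms M.K.lattice_axioms
    by (simp add: bounded_lattice_hom_def join_pres_def meet_pres_def)
qed

abbreviation "pullback i \<equiv> cong_pullback (L i) (h i)"

text \<open>This is \<open>proj_map\<close>, the compatibility of \<open>H\<close> with the
  projections, read on congruences. It reduces pullbacks along \<open>H\<close> to pullbacks along
  the \<open>h i\<close>.\<close>

lemma pullback_P:
  "i \<in> {1..n} \<Longrightarrow> cong_pullback L.K H (M.P i \<psi>) = L.P i (pullback i \<psi>)"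
  by (auto simp: cong_pullback_def)

lemma pullback_Con: "i \<in> {1..n} \<Longrightarrow> \<psi> \<in> Con (M i) \<Longrightarrow> pullback i \<psi> \<in> Con (L i)"
  using hom[of i] by (intro Con_pullback) (auto simp: bounded_lattice_hom_def)

text \<open>The inclusion \<open>q i\<close> carries pairs in the kernel of \<open>h i\<close> to
  pairs in the kernel of \<open>H\<close>, and the projection \<open>p i\<close> carries them
  back.\<close>

lemma Ker_subset_P_iff:
  assumes "i \<in> {1..n}"
  shows "Ker L.K M.K H \<subseteq> L.P i \<phi> \<longleftrightarrow> Ker (L i) (M i) (h i) \<subseteq> \<phi>"
proof
  assume *: "Ker L.K M.K H \<subseteq> L.P i \<phi>"
  show "Ker (L i) (M i) (h i) \<subseteq> \<phi>"
  proof clarify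
    fix x y assume "(x, y) \<in> Ker (L i) (M i) (h i)"
    then have xy: "x \<in> carrier (L i)" "y \<in> carrier (L i)" "h i x = h i y"
      by (auto simp: Ker_def cong_pullback_def)
    then have "(L.q i x, L.q i y) \<in> Ker L.K M.K H"
      using assms by (simp add: Ker_def cong_pullback_def map_inj Id_on_iff)
    then have "(L.q i x, L.q i y) \<in> L.P i \<phi>"
      using * by blast
    then show "(x, y) \<in> \<phi>"
      using assms xy by (simp add: cong_pullback_def L.proj_inj)
  qed
next
  assume *: "Ker (L i) (M i) (h i) \<subseteq> \<phi>"
  show "Ker L.K M.K H \<subseteq> L.P i \<phi>"
  proof clarify
    fix C D assume "(C, D) \<in> Ker L.K M.K H"
    then have CD: "C \<in> carrier L.K" "D \<in> carrier L.K" "H C = H D"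
      by (auto simp: Ker_def cong_pullback_def)
    then have "h i (L.p i C) = h i (L.p i D)"
      using assms by (metis proj_map)
    then have "(L.p i C, L.p i D) \<in> Ker (L i) (M i) (h i)"
      using assms CD by (simp add: Ker_def cong_pullback_def Id_on_iff)
    then show "(C, D) \<in> L.P i \<phi>"
      using * CD by (auto simp: cong_pullback_def)
  qed
qed

section \<open>Admissibility, Going Up and Lying Over\<close>

lemma admissible_osum_iff:
  "admissible L.K M.K H \<longleftrightarrow> (\<forall>i\<in>{1..n}. admissible (L i) (M i) (h i))"
proof
  assume adm: "admissible L.K M.K H"
  have "pullback i \<psi> \<in> Spec (L i)" if i: "i \<in> {1..n}" and \<psi>: "\<psi> \<in> Spec (M i)" for i \<psi>
  proof -
    have "L.P i (pullback i \<psi>) \<in> Spec L.K"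
      using adm M.P_Spec[OF i \<psi>] pullback_P[OF i] unfolding admissible_def by metis
    then obtain j \<chi> where j: "j \<in> {1..n}" "\<chi> \<in> Spec (L j)" "L.P i (pullback i \<psi>) = L.P j \<chi>"
      by (rule L.Spec_osumE)
    note Con = pullback_Con[OF i SpecD(1)[OF \<psi>]]
    \<comment> \<open>The pullback is known to be prime only as some \<open>P j \<chi>\<close>.
      Primes from different summands are incomparable, so the index is \<open>i\<close>, and
      \<open>Q_P\<close> then cancels \<open>P i\<close>.\<close>
    have "i = j"
      using L.P_subset_P_index[OF i j(1) Con j(2)] j(3) by blast
    then have "pullback i \<psi> = \<chi>"
      using j(3) L.Q_P[OF i Con] L.Q_P[OF j(1) SpecD(1)[OF j(2)]] by metis
    then show ?thesis using j(2) \<open>i = j\<close> by simp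
  qed
  then show "\<forall>i\<in>{1..n}. admissible (L i) (M i) (h i)"
    using hom by (simp add: admissible_def)
next
  assume adm: "\<forall>i\<in>{1..n}. admissible (L i) (M i) (h i)"
  have "cong_pullback L.K H \<psi> \<in> Spec L.K" if "\<psi> \<in> Spec M.K" for \<psi>
    using that
  proof (rule M.Spec_osumE)
    fix i \<chi> assume "i \<in> {1..n}" "\<chi> \<in> Spec (M i)" "\<psi> = M.P i \<chi>"
    then show ?thesis
      using adm L.P_Spec by (simp add: pullback_P admissible_def)
  qed
  then show "admissible L.K M.K H"
    using map_hom by (simp add: admissible_def)
qed

lemma pullback_Spec:
  assumes "admissible L.K M.K H" "i \<in> {1..n}" "\<psi> \<in> Spec (M i)"
  shows "pullback i \<psi> \<in> Spec (L i)"
  using assms unfolding admissible_osum_iff by (auto simp: admissible_def)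

lemma GU_osum_iff:
  assumes adm: "admissible L.K M.K H"
  shows "fulfills_GU L.K M.K H \<longleftrightarrow> (\<forall>i\<in>{1..n}. fulfills_GU (L i) (M i) (h i))"
proof
  assume GU: "fulfills_GU L.K M.K H"
  \<comment> \<open>The lower prime congruence in Going Up is determined by
    \<open>\<phi>\<^sub>1\<close>, so it is written as its pullback. The data are pushed to the sums
    by \<open>P i\<close>, and the solution found there is restricted again.\<close>
  have "\<exists>\<psi>\<^sub>1\<in>Spec (M i). \<phi>\<^sub>1 \<subseteq> \<psi>\<^sub>1 \<and> pullback i \<psi>\<^sub>1 = \<psi>"
    if i: "i \<in> {1..n}" and \<psi>: "\<psi> \<in> Spec (L i)" and \<phi>\<^sub>1: "\<phi>\<^sub>1 \<in> Spec (M i)"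
      and sub: "pullback i \<phi>\<^sub>1 \<subseteq> \<psi>" for i \<psi> \<phi>\<^sub>1
  proof -
    have "L.P i (pullback i \<phi>\<^sub>1) \<subseteq> L.P i \<psi>"
      using sub by (auto simp: cong_pullback_def[of L.K])
    moreover have "L.P i (pullback i \<phi>\<^sub>1) \<in> Spec L.K" "L.P i \<psi> \<in> Spec L.K" "M.P i \<phi>\<^sub>1 \<in> Spec M.K"
      using i \<psi> \<phi>\<^sub>1 pullback_Spec[OF adm] by (simp_all only: L.P_Spec M.P_Spec)
    ultimately obtain \<Psi>\<^sub>1 where \<Psi>\<^sub>1: "\<Psi>\<^sub>1 \<in> Spec M.K" "M.P i \<phi>\<^sub>1 \<subseteq> \<Psi>\<^sub>1"
        "cong_pullback L.K H \<Psi>\<^sub>1 = L.P i \<psi>"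
      using GU pullback_P[OF i] unfolding fulfills_GU_def by meson
    obtain j \<chi> where j: "j \<in> {1..n}" "\<chi> \<in> Spec (M j)" "\<Psi>\<^sub>1 = M.P j \<chi>"
      using \<Psi>\<^sub>1(1) by (rule M.Spec_osumE)
    \<comment> \<open>The solution contains \<open>M.P i \<phi>\<^sub>1\<close>, which forces it to
      come from the same summand.\<close>
    have [simp]: "j = i"
      using M.P_subset_P_index[OF i j(1) SpecD(1)[OF \<phi>\<^sub>1] j(2)] \<Psi>\<^sub>1(2) j(3) by simp
    have "\<chi> \<in> Spec (M i)" using j(2) by simp
    moreover have "\<phi>\<^sub>1 \<subseteq> \<chi>"
      using M.P_mono_iff[OF i SpecD(1)[OF \<phi>\<^sub>1]] SpecD(1)[OF j(2)] \<Psi>\<^sub>1(2) j(3) by simp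
    moreover have "L.P i (pullback i \<chi>) = L.P i \<psi>"
      using \<Psi>\<^sub>1(3) j(3) pullback_P[OF i] by simp
    then have "pullback i \<chi> = \<psi>"
      using L.Q_P[OF i] pullback_Con[OF i] SpecD(1)[OF \<psi>] SpecD(1)[OF \<open>\<chi> \<in> Spec (M i)\<close>] by metis
    ultimately show ?thesis by blast
  qed
  then show "\<forall>i\<in>{1..n}. fulfills_GU (L i) (M i) (h i)"
    unfolding fulfills_GU_def by blast
next
  assume GU: "\<forall>i\<in>{1..n}. fulfills_GU (L i) (M i) (h i)"
  have "\<exists>\<psi>\<^sub>1\<in>Spec M.K. \<phi>\<^sub>1 \<subseteq> \<psi>\<^sub>1 \<and> cong_pullback L.K H \<psi>\<^sub>1 = \<psi>"
    if \<psi>: "\<psi> \<in> Spec L.K" and \<phi>\<^sub>1: "\<phi>\<^sub>1 \<in> Spec M.K" and sub: "cong_pullback L.K H \<phi>\<^sub>1 \<subseteq> \<psi>" for \<psi> \<phi>\<^sub>1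
  proof -
    obtain i \<chi> where i: "i \<in> {1..n}" "\<chi> \<in> Spec (M i)" "\<phi>\<^sub>1 = M.P i \<chi>"
      using \<phi>\<^sub>1 by (rule M.Spec_osumE)
    obtain j \<omega> where j: "j \<in> {1..n}" "\<omega> \<in> Spec (L j)" "\<psi> = L.P j \<omega>"
      using \<psi> by (rule L.Spec_osumE)
    note Con = pullback_Con[OF i(1) SpecD(1)[OF i(2)]]
    \<comment> \<open>The inclusion between the two primes of the sum places both in one summand,
      where Going Up for that \<open>h i\<close> applies.\<close>
    have sub': "L.P i (pullback i \<chi>) \<subseteq> L.P j \<omega>"
      using sub pullback_P[OF i(1)] i(3) j(3) by simp
    then have [simp]: "j = i"
      using L.P_subset_P_index[OF i(1) j(1) Con j(2)] by simp
    have "pullback i \<chi> \<subseteq> \<omega>"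
      using sub' L.P_mono_iff[OF i(1) Con] SpecD(1)[OF j(2)] by simp
    moreover have "\<omega> \<in> Spec (L i)" using j(2) by simp
    ultimately obtain \<omega>\<^sub>1 where "\<omega>\<^sub>1 \<in> Spec (M i)" "\<chi> \<subseteq> \<omega>\<^sub>1" "pullback i \<omega>\<^sub>1 = \<omega>"
      using bspec[OF GU i(1)] i(2) pullback_Spec[OF adm i(1,2)]
      unfolding fulfills_GU_def by blast
    then show ?thesis
      using i j M.P_Spec[OF i(1)] M.P_mono_iff[OF i(1)] pullback_P[OF i(1)]
      by (intro bexI[of _ "M.P i \<omega>\<^sub>1"]) (simp_all add: SpecD(1))
  qed
  then show "fulfills_GU L.K M.K H"
    unfolding fulfills_GU_def by blast
qed

lemma LO_osum_iff: "fulfills_LO L.K M.K H \<longleftrightarrow> (\<forall>i\<in>{1..n}. fulfills_LO (L i) (M i) (h i))"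
proof
  assume LO: "fulfills_LO L.K M.K H"
  have "\<exists>\<phi>\<^sub>1\<in>Spec (M i). pullback i \<phi>\<^sub>1 = \<phi>"
    if i: "i \<in> {1..n}" and \<phi>: "\<phi> \<in> Spec (L i)" and ker: "Ker (L i) (M i) (h i) \<subseteq> \<phi>" for i \<phi>
  proof -
    \<comment> \<open>The kernel condition passes to the sum by \<open>Ker_subset_P_iff\<close>. The
      prime obtained there may a priori come from any summand \<open>j\<close>; its pullback
      \<open>L.P i \<phi>\<close> then forces \<open>j = i\<close>.\<close>
    obtain \<Phi>\<^sub>1 where \<Phi>\<^sub>1: "\<Phi>\<^sub>1 \<in> Spec M.K" "cong_pullback L.K H \<Phi>\<^sub>1 = L.P i \<phi>"
      using LO L.P_Spec[OF i \<phi>] Ker_subset_P_iff[OF i] ker unfolding fulfills_LO_def by meson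
    obtain j \<chi> where j: "j \<in> {1..n}" "\<chi> \<in> Spec (M j)" "\<Phi>\<^sub>1 = M.P j \<chi>"
      using \<Phi>\<^sub>1(1) by (rule M.Spec_osumE)
    note Con = pullback_Con[OF j(1) SpecD(1)[OF j(2)]]
    have eq: "L.P j (pullback j \<chi>) = L.P i \<phi>"
      using \<Phi>\<^sub>1(2) j(3) pullback_P[OF j(1)] by simp
    then have "j = i"
      using L.P_subset_P_index[OF j(1) i Con \<phi>] by simp
    then show ?thesis
      using j(2) eq L.Q_P[OF i] Con SpecD(1)[OF \<phi>] by metis
  qed
  then show "\<forall>i\<in>{1..n}. fulfills_LO (L i) (M i) (h i)"
    unfolding fulfills_LO_def by blast
next
  assume LO: "\<forall>i\<in>{1..n}. fulfills_LO (L i) (M i) (h i)"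
  have "\<exists>\<phi>\<^sub>1\<in>Spec M.K. cong_pullback L.K H \<phi>\<^sub>1 = \<phi>"
    if \<phi>: "\<phi> \<in> Spec L.K" and ker: "Ker L.K M.K H \<subseteq> \<phi>" for \<phi>
  proof -
    obtain i \<chi> where i: "i \<in> {1..n}" "\<chi> \<in> Spec (L i)" "\<phi> = L.P i \<chi>"
      using \<phi> by (rule L.Spec_osumE)
    then obtain \<chi>\<^sub>1 where "\<chi>\<^sub>1 \<in> Spec (M i)" "pullback i \<chi>\<^sub>1 = \<chi>"
      using LO ker Ker_subset_P_iff[OF i(1)] unfolding fulfills_LO_def by meson
    then show ?thesis
      using i M.P_Spec[OF i(1)] pullback_P[OF i(1)] by metis
  qed
  then show "fulfills_LO L.K M.K H"
    unfolding fulfills_LO_def by blast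
qed

end

theorem corollary6p8:
  fixes n :: nat
    and L :: "nat \<Rightarrow> 'a gorder"
    and M :: "nat \<Rightarrow> 'b gorder"
    and h :: "nat \<Rightarrow> 'a \<Rightarrow> 'b"
  assumes "n \<ge> 1"
    and "\<And>i. i \<in> {1..n} \<Longrightarrow> bounded_lattice (L i)"
    and "\<And>i. i \<in> {1..n} \<Longrightarrow> bounded_lattice (M i)"
    and "\<And>i. i \<in> {1..n} \<Longrightarrow> h i \<in> bounded_lattice_hom (L i) (M i)"
  shows "(admissible (osum n L) (osum n M) (osum_map n M h) \<longleftrightarrow>
            (\<forall>i \<in> {1..n}. admissible (L i) (M i) (h i))) \<and>
         (admissible (osum n L) (osum n M) (osum_map n M h) \<longrightarrow>
            (fulfills_GU (osum n L) (osum n M) (osum_map n M h) \<longleftrightarrow>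
             (\<forall>i \<in> {1..n}. fulfills_GU (L i) (M i) (h i)))) \<and>
         (admissible (osum n L) (osum n M) (osum_map n M h) \<longrightarrow>
            (fulfills_LO (osum n L) (osum n M) (osum_map n M h) \<longleftrightarrow>
             (\<forall>i \<in> {1..n}. fulfills_LO (L i) (M i) (h i))))"
proof -
  interpret ordinal_sum_hom n L M h
    by (intro ordinal_sum_hom.intro ordinal_sum.intro ordinal_sum_hom_axioms.intro)
      (erule assms | rule assms)+
  show ?thesis
    using admissible_osum_iff GU_osum_iff LO_osum_iff by blast
qed

end
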